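(* Let $(\mathcal G,\rho,\omega)$ be a symplectic Lie--Rinehart--Jacobi algebra over $A$ with extension $(\widehat{\mathcal G}_\omega,\widehat\rho)$ and canonical form $\eta$. For $x\in\mathcal G$ and $f\in A$, the element $x+fe\in\widehat{\mathcal G}_\omega$ is a strict symmetry of $\eta$ if and only if $x=X_f$. Thus $$\mathrm{Cont}_{\mathrm{str}}(\widehat{\mathcal G}_\omega,\eta)=\{X_f+fe: f\in A\}.$$
   Context: $K$ is a commutative field of characteristic zero and $A$ a commutative unital $K$-algebra; $L_a$ is multiplication by $a$. $\mathrm{Diff}^1_K(A)$ is the set of $K$-linear $D:A\to A$ with $[[D,L_a],L_b]=0$ for all $a,b\in A$. A Lie--Rinehart--Jacobi (LRJ) algebra over $A$ is an $A$-module $\mathcal G$ with a $K$-Lie algebra structure and an $A$-linear map (anchor) $\rho:\mathcal G\to\mathrm{Diff}^1_K(A)$ which is a Lie algebra morphism and satisfies $[x,ay]=a[x,y]+(\rho(x)(a)-a\rho(x)(1_A))y$. $C^p_\rho(\mathcal G,A)=\mathrm{Alt}^p_A(\mathcal G,A)$ is the module of alternating $A$-multilinear maps $\mathcal G^p\to A$, with differential $(d_\rho\beta)(x_0,\dots,x_p)=\sum_i(-1)^i\rho(x_i)\beta(x_0,\dots,\widehat{x_i},\dots,x_p)+\sum_{i<j}(-1)^{i+j}\beta([x_i,x_j],x_0,\dots,\widehat{x_i},\dots,\widehat{x_j},\dots,x_p)$; in particular $(d_\rho a)(x)=\rho(x)(a)$. $i_x$ is the interior product and $\mathcal L^\rho_x=i_xd_\rho+d_\rho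 i_x$. The same notation is used for any LRJ algebra. A symplectic form on $(\mathcal G,\rho)$ is $\omega\in C^2_\rho(\mathcal G,A)$ with $d_\rho\omega=0$ and $\omega^\flat:\mathcal G\to\mathcal G^*=\mathrm{Hom}_A(\mathcal G,A)$, $x\mapsto i_x\omega$, an isomorphism of $A$-modules; $(\mathcal G,\rho,\omega)$ is then a symplectic LRJ algebra. The symplectic gradient $X_a\in\mathcal G$ of $a\in A$ is defined by $i_{X_a}\omega=d_\rho a$. The extension: $\widehat{\mathcal G}_\omega=\mathcal G\oplus Ae$ with $e$ generating a free summand of rank one, with bracket $[x+fe,y+ge]_\omega=[x,y]+(\rho(x)(g)-\rho(y)(f)+\omega(x,y))e$, anchor $\widehat\rho(x+fe)=\rho(x)$, projection $\pi(x+fe)=x$ and canonical form $\eta(x+fe)=f$. $(\widehat{\mathcal G}_\omega,\widehat\rho)$ is an LRJ algebra. An element $u\in\widehat{\mathcal G}_\omega$ is a strict symmetry of $\eta$ if $\mathcal L^{\widehat\rho}_u\eta=0$; $\mathrm{Cont}_{\mathrm{str}}(\widehat{\mathcal G}_\omega,\eta)$ is the set of strict symmetries. *)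

theory Defs
  imports "HOL-Algebra.Module" "HOL-Library.FuncSet"
begin

text \<open>
  All structures are carrier-based, so that the zero algebra is not excluded.  A module over
  \<open>A\<close> equipped with a bracket and an anchor is a record extending the library's modules;
  as in the library's modules, the inherited fields \<open>mult\<close> and \<open>one\<close> are irrelevant.
\<close>

record ('a, 'g) lrj = "('a, 'g) module" +
  bracket :: "'g \<Rightarrow> 'g \<Rightarrow> 'g"
  anchor :: "'g \<Rightarrow> 'a \<Rightarrow> 'a"

definition char_zero_field :: "('k, 'r) ring_scheme \<Rightarrow> bool" where
  "char_zero_field K \<longleftrightarrow>
     field K \<and> (\<forall>n::nat. n > 0 \<longrightarrow> [n] \<cdot>\<^bsub>K\<^esub> \<one>\<^bsub>K\<^esub> \<noteq> \<zero>\<^bsub>K\<^esub>)"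

definition lin_maps ::
  "('r, 'p) ring_scheme \<Rightarrow> ('r, 'v, 'm) module_scheme \<Rightarrow> ('r, 'w, 'n) module_scheme \<Rightarrow> ('v \<Rightarrow> 'w) set"
  where
  "lin_maps R V W = {h \<in> carrier V \<rightarrow> carrier W.
     (\<forall>x\<in>carrier V. \<forall>y\<in>carrier V. h (x \<oplus>\<^bsub>V\<^esub> y) = h x \<oplus>\<^bsub>W\<^esub> h y) \<and>
     (\<forall>c\<in>carrier R. \<forall>x\<in>carrier V. h (c \<odot>\<^bsub>V\<^esub> x) = c \<odot>\<^bsub>W\<^esub> h x)}"

definition module_isos ::
  "('r, 'p) ring_scheme \<Rightarrow> ('r, 'v, 'm) module_scheme \<Rightarrow> ('r, 'w, 'n) module_scheme \<Rightarrow> ('v \<Rightarrow> 'w) set"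
  where
  "module_isos R V W = {h \<in> lin_maps R V W. bij_betw h (carrier V) (carrier W)}"


section \<open>First-order differential operators\<close>

definition commutator :: "('a, 'r) ring_scheme \<Rightarrow> ('a \<Rightarrow> 'a) \<Rightarrow> ('a \<Rightarrow> 'a) \<Rightarrow> 'a \<Rightarrow> 'a" where
  "commutator A D E = (\<lambda>c. D (E c) \<ominus>\<^bsub>A\<^esub> E (D c))"

definition mult_op :: "('a, 'r) ring_scheme \<Rightarrow> 'a \<Rightarrow> 'a \<Rightarrow> 'a" where
  "mult_op A a = (\<lambda>c. a \<otimes>\<^bsub>A\<^esub> c)"

definition Diff1 :: "('k, 'r) ring_scheme \<Rightarrow> ('k, 'a, 'm) module_scheme \<Rightarrow> ('a \<Rightarrow> 'a) set" where
  "Diff1 K A = {D \<in> lin_maps K A A.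
     \<forall>a\<in>carrier A. \<forall>b\<in>carrier A. \<forall>c\<in>carrier A.
       commutator A (commutator A D (mult_op A a)) (mult_op A b) c = \<zero>\<^bsub>A\<^esub>}"


section \<open>Lie--Rinehart--Jacobi algebras\<close>

definition restrict_scalars ::
  "('k, 'a, 'm) module_scheme \<Rightarrow> ('a, 'g, 'n) module_scheme \<Rightarrow> ('k, 'g) module" where
  "restrict_scalars A G =
     \<lparr>carrier = carrier G, mult = mult G, one = one G, zero = zero G, add = add G,
      smult = (\<lambda>c x. (c \<odot>\<^bsub>A\<^esub> \<one>\<^bsub>A\<^esub>) \<odot>\<^bsub>G\<^esub> x)\<rparr>"

definition lie_algebra ::
  "('k, 'r) ring_scheme \<Rightarrow> ('k, 'v, 'm) module_scheme \<Rightarrow> ('v \<Rightarrow> 'v \<Rightarrow> 'v) \<Rightarrow> bool" where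
  "lie_algebra K V br \<longleftrightarrow> module K V \<and>
     (\<forall>x\<in>carrier V. (\<lambda>y. br x y) \<in> lin_maps K V V) \<and>
     (\<forall>y\<in>carrier V. (\<lambda>x. br x y) \<in> lin_maps K V V) \<and>
     (\<forall>x\<in>carrier V. br x x = \<zero>\<^bsub>V\<^esub>) \<and>
     (\<forall>x\<in>carrier V. \<forall>y\<in>carrier V. \<forall>z\<in>carrier V.
        br x (br y z) \<oplus>\<^bsub>V\<^esub> br y (br z x) \<oplus>\<^bsub>V\<^esub> br z (br x y) = \<zero>\<^bsub>V\<^esub>)"

text \<open>
  Operators on \<open>A\<close> are compared on \<open>carrier A\<close> only.  The \<open>A\<close>-module structure on \<open>Diff1\<close> is
  \<open>(a D)(b) = a D(b)\<close>; the \<open>K\<close>-linearity of the anchor follows from its \<open>A\<close>-linearity.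
\<close>

locale lrj_algebra =
  fixes K :: "('k, 'r) ring_scheme"
    and A :: "('k, 'a, 'm) module_scheme"
    and G :: "('a, 'g, 'n) lrj_scheme"
  assumes char_zero_field: "char_zero_field K"
    and algebra: "algebra K A"
    and module: "module A G"
    and lie_algebra: "lie_algebra K (restrict_scalars A G) (bracket G)"
    and anchor_Diff1: "\<And>x. x \<in> carrier G \<Longrightarrow> anchor G x \<in> Diff1 K A"
    and anchor_add: "\<And>x y b. \<lbrakk>x \<in> carrier G; y \<in> carrier G; b \<in> carrier A\<rbrakk>
      \<Longrightarrow> anchor G (x \<oplus>\<^bsub>G\<^esub> y) b = anchor G x b \<oplus>\<^bsub>A\<^esub> anchor G y b"
    and anchor_smult: "\<And>a x b. \<lbrakk>a \<in> carrier A; x \<in> carrier G; b \<in> carrier A\<rbrakk>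
      \<Longrightarrow> anchor G (a \<odot>\<^bsub>G\<^esub> x) b = a \<otimes>\<^bsub>A\<^esub> anchor G x b"
    and anchor_bracket: "\<And>x y b. \<lbrakk>x \<in> carrier G; y \<in> carrier G; b \<in> carrier A\<rbrakk>
      \<Longrightarrow> anchor G (bracket G x y) b = commutator A (anchor G x) (anchor G y) b"
    and bracket_smult: "\<And>a x y. \<lbrakk>a \<in> carrier A; x \<in> carrier G; y \<in> carrier G\<rbrakk>
      \<Longrightarrow> bracket G x (a \<odot>\<^bsub>G\<^esub> y) =
        (a \<odot>\<^bsub>G\<^esub> bracket G x y) \<oplus>\<^bsub>G\<^esub>
        ((anchor G x a \<ominus>\<^bsub>A\<^esub> (a \<otimes>\<^bsub>A\<^esub> anchor G x \<one>\<^bsub>A\<^esub>)) \<odot>\<^bsub>G\<^esub> y)"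


section \<open>Cochains\<close>

text \<open>
  A \<open>p\<close>-tuple is a list of length \<open>p\<close>.  Cochains are extensional functions on \<open>p\<close>-tuples, so that
  equality of cochains is equality of functions.
\<close>

definition tuples :: "('a, 'g, 'n) module_scheme \<Rightarrow> nat \<Rightarrow> 'g list set" where
  "tuples G p = {xs. length xs = p \<and> set xs \<subseteq> carrier G}"

definition Alt ::
  "('a, 'r) ring_scheme \<Rightarrow> ('a, 'g, 'n) module_scheme \<Rightarrow> nat \<Rightarrow> ('g list \<Rightarrow> 'a) set" where
  "Alt A G p = {\<beta> \<in> tuples G p \<rightarrow>\<^sub>E carrier A.
     (\<forall>xs\<in>tuples G p. \<forall>i<p. \<forall>x\<in>carrier G. \<forall>y\<in>carrier G.
        \<beta> (xs[i := x \<oplus>\<^bsub>G\<^esub> y]) = \<beta> (xs[i := x]) \<oplus>\<^bsub>A\<^esub> \<beta> (xs[i := y])) \<and>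
     (\<forall>xs\<in>tuples G p. \<forall>i<p. \<forall>a\<in>carrier A. \<forall>x\<in>carrier G.
        \<beta> (xs[i := a \<odot>\<^bsub>G\<^esub> x]) = a \<otimes>\<^bsub>A\<^esub> \<beta> (xs[i := x])) \<and>
     (\<forall>xs\<in>tuples G p. \<forall>i j. i < j \<and> j < p \<and> xs ! i = xs ! j \<longrightarrow> \<beta> xs = \<zero>\<^bsub>A\<^esub>)}"

definition cochains ::
  "('a, 'r) ring_scheme \<Rightarrow> ('a, 'g, 'n) module_scheme \<Rightarrow> nat \<Rightarrow> ('a, 'g list \<Rightarrow> 'a) module" where
  "cochains A G p =
     \<lparr>carrier = Alt A G p, mult = undefined, one = undefined,
      zero = (\<lambda>xs\<in>tuples G p. \<zero>\<^bsub>A\<^esub>),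
      add = (\<lambda>\<beta> \<gamma>. \<lambda>xs\<in>tuples G p. \<beta> xs \<oplus>\<^bsub>A\<^esub> \<gamma> xs),
      smult = (\<lambda>a \<beta>. \<lambda>xs\<in>tuples G p. a \<otimes>\<^bsub>A\<^esub> \<beta> xs)\<rparr>"

definition cochain0 :: "('a, 'g, 'n) module_scheme \<Rightarrow> 'a \<Rightarrow> 'g list \<Rightarrow> 'a" where
  "cochain0 G a = (\<lambda>xs\<in>tuples G 0. a)"

definition omit :: "nat \<Rightarrow> 'g list \<Rightarrow> 'g list" where
  "omit i xs = take i xs @ drop (Suc i) xs"

definition altsign :: "('a, 'r) ring_scheme \<Rightarrow> nat \<Rightarrow> 'a" where
  "altsign A n = (\<ominus>\<^bsub>A\<^esub> \<one>\<^bsub>A\<^esub>) [^]\<^bsub>A\<^esub> n"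

text \<open>
  \<open>differential A G p\<close> maps \<open>p\<close>-cochains to \<open>(p+1)\<close>-cochains.  Since \<open>i < j\<close>, the \<open>j\<close>-th entry is
  omitted first.
\<close>

definition differential ::
  "('a, 'r) ring_scheme \<Rightarrow> ('a, 'g, 'n) lrj_scheme \<Rightarrow> nat \<Rightarrow> ('g list \<Rightarrow> 'a) \<Rightarrow> 'g list \<Rightarrow> 'a" where
  "differential A G p \<beta> = (\<lambda>xs\<in>tuples G (Suc p).
     (\<Oplus>\<^bsub>A\<^esub>i\<in>{..p}. altsign A i \<otimes>\<^bsub>A\<^esub> anchor G (xs ! i) (\<beta> (omit i xs)))
     \<oplus>\<^bsub>A\<^esub>
     (\<Oplus>\<^bsub>A\<^esub>j\<in>{..p}. \<Oplus>\<^bsub>A\<^esub>i\<in>{..<j}.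
        altsign A (i + j) \<otimes>\<^bsub>A\<^esub> \<beta> (bracket G (xs ! i) (xs ! j) # omit i (omit j xs))))"

text \<open>
  \<open>interior G p x\<close> maps \<open>(p+1)\<close>-cochains to \<open>p\<close>-cochains; the interior product of a
  \<open>0\<close>-cochain is zero.
\<close>

definition interior ::
  "('a, 'g, 'n) module_scheme \<Rightarrow> nat \<Rightarrow> 'g \<Rightarrow> ('g list \<Rightarrow> 'a) \<Rightarrow> 'g list \<Rightarrow> 'a" where
  "interior G p x \<beta> = (\<lambda>xs\<in>tuples G p. \<beta> (x # xs))"

definition lie_derivative ::
  "('a, 'r) ring_scheme \<Rightarrow> ('a, 'g, 'n) lrj_scheme \<Rightarrow> nat \<Rightarrow> 'g \<Rightarrow> ('g list \<Rightarrow> 'a) \<Rightarrow> 'g list \<Rightarrow> 'a"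
  where
  "lie_derivative A G p x \<beta> =
     interior G p x (differential A G p \<beta>) \<oplus>\<^bsub>cochains A G p\<^esub>
     (case p of 0 \<Rightarrow> \<zero>\<^bsub>cochains A G p\<^esub>
      | Suc q \<Rightarrow> differential A G q (interior G q x \<beta>))"


section \<open>Symplectic structures and the extension\<close>

text \<open>The dual module \<open>Hom(G, A)\<close> is \<open>cochains A G 1\<close>.\<close>

locale symplectic_lrj_algebra = lrj_algebra K A G
  for K :: "('k, 'r) ring_scheme"
    and A :: "('k, 'a, 'm) module_scheme"
    and G :: "('a, 'g, 'n) lrj_scheme" +
  fixes \<omega> :: "'g list \<Rightarrow> 'a"
  assumes omega_cochain: "\<omega> \<in> carrier (cochains A G 2)"
    and omega_closed: "differential A G 2 \<omega> = \<zero>\<^bsub>cochains A G 3\<^esub>"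
    and omega_flat_iso: "(\<lambda>x. interior G 1 x \<omega>) \<in> module_isos A G (cochains A G 1)"

definition symplectic_gradient ::
  "('a, 'r) ring_scheme \<Rightarrow> ('a, 'g, 'n) lrj_scheme \<Rightarrow> ('g list \<Rightarrow> 'a) \<Rightarrow> 'a \<Rightarrow> 'g" where
  "symplectic_gradient A G \<omega> a =
     (THE x. x \<in> carrier G \<and> interior G 1 x \<omega> = differential A G 0 (cochain0 G a))"

text \<open>The pair \<open>(x, f)\<close> stands for \<open>x + f e\<close>.\<close>

definition extension ::
  "('a, 'r) ring_scheme \<Rightarrow> ('a, 'g, 'n) lrj_scheme \<Rightarrow> ('g list \<Rightarrow> 'a) \<Rightarrow> ('a, 'g \<times> 'a) lrj" where
  "extension A G \<omega> =
     \<lparr>carrier = carrier G \<times> carrier A, mult = undefined, one = undefined,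
      zero = (\<zero>\<^bsub>G\<^esub>, \<zero>\<^bsub>A\<^esub>),
      add = (\<lambda>(x, f) (y, g). (x \<oplus>\<^bsub>G\<^esub> y, f \<oplus>\<^bsub>A\<^esub> g)),
      smult = (\<lambda>a (x, f). (a \<odot>\<^bsub>G\<^esub> x, a \<otimes>\<^bsub>A\<^esub> f)),
      bracket = (\<lambda>(x, f) (y, g).
        (bracket G x y, (anchor G x g \<ominus>\<^bsub>A\<^esub> anchor G y f) \<oplus>\<^bsub>A\<^esub> \<omega> [x, y])),
      anchor = (\<lambda>(x, f). anchor G x)\<rparr>"

definition canonical_form ::
  "('a, 'r) ring_scheme \<Rightarrow> ('a, 'g, 'n) lrj_scheme \<Rightarrow> ('g list \<Rightarrow> 'a) \<Rightarrow> ('g \<times> 'a) list \<Rightarrow> 'a" where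
  "canonical_form A G \<omega> = (\<lambda>us\<in>tuples (extension A G \<omega>) 1. snd (hd us))"

definition strict_symmetry ::
  "('a, 'r) ring_scheme \<Rightarrow> ('a, 'h, 'n) lrj_scheme \<Rightarrow> ('h list \<Rightarrow> 'a) \<Rightarrow> 'h \<Rightarrow> bool" where
  "strict_symmetry A H \<eta> u \<longleftrightarrow> lie_derivative A H 1 u \<eta> = \<zero>\<^bsub>cochains A H 1\<^esub>"

definition Cont_str ::
  "('a, 'r) ring_scheme \<Rightarrow> ('a, 'h, 'n) lrj_scheme \<Rightarrow> ('h list \<Rightarrow> 'a) \<Rightarrow> 'h set" where
  "Cont_str A H \<eta> = {u \<in> carrier H. strict_symmetry A H \<eta> u}"

end

theory Submission
  imports Defs
begin

text \<open>
  On the extension, the term \<open>\<omega>(x, y) e\<close> in the bracket is the only part that the differential of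
  the canonical form \<open>\<eta>\<close> sees: the two anchor terms of \<open>d\<eta>\<close> cancel against the two anchor terms
  of the bracket, so that \<open>d\<eta> = - \<pi>\<^sup>* \<omega>\<close> (lemma \<open>differential_canonical_form\<close>).  Also
  \<open>i\<^sub>u \<eta> = f\<close> for \<open>u = x + f e\<close>.  Cartan's formula therefore gives
  \<open>\<L>\<^sub>u \<eta> = \<pi>\<^sup>* (d f - i\<^sub>x \<omega>)\<close> (lemma \<open>lie_derivative_canonical_form\<close>).  Since \<open>\<pi>\<close> is onto, this
  vanishes exactly when \<open>i\<^sub>x \<omega> = d f\<close>, which is the equation that defines the symplectic gradient
  of \<open>f\<close>; nondegeneracy of \<open>\<omega>\<close> makes the solution of that equation exist and be unique (lemma
  \<open>symplectic_gradient_iff\<close>).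
\<close>

lemma extensional_eq_iff:
  assumes "f \<in> extensional S" "g \<in> extensional S"
  shows "f = g \<longleftrightarrow> (\<forall>x\<in>S. f x = g x)"
  using extensionalityI[OF assms] by blast

lemma tuples_0: "tuples G 0 = {[]}"
  by (auto simp: tuples_def)

lemma tuples_1: "tuples G (Suc 0) = {[x] | x. x \<in> carrier G}"
  by (auto simp: tuples_def length_Suc_conv)

lemma tuples_2: "tuples G 2 = {[x, y] | x y. x \<in> carrier G \<and> y \<in> carrier G}"
  by (auto simp: tuples_def length_Suc_conv numeral_2_eq_2)

text \<open>
  The degree \<open>0\<close> and \<open>1\<close> cases of the differential are stated for an arbitrary bracket and anchor,
  so that they apply to the extension without first showing that it is a Lie--Rinehart--Jacobi
  algebra.
\<close>

lemma differential_degree_0: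
  assumes "cring A" "x \<in> carrier H" "anchor H x (\<beta> []) \<in> carrier A"
  shows "differential A H 0 \<beta> [x] = anchor H x (\<beta> [])"
proof -
  interpret cring A by fact
  have "[x] \<in> tuples H (Suc 0)"
    using assms(2) by (simp add: tuples_def)
  then show ?thesis
    using assms(3) by (simp add: differential_def omit_def altsign_def)
qed

lemma differential_degree_1:
  assumes "cring A" "x \<in> carrier H" "y \<in> carrier H"
    and "anchor H x (\<beta> [y]) \<in> carrier A" "anchor H y (\<beta> [x]) \<in> carrier A"
    and "\<beta> [bracket H x y] \<in> carrier A"
  shows "differential A H 1 \<beta> [x, y] =
    (anchor H x (\<beta> [y]) \<ominus>\<^bsub>A\<^esub> anchor H y (\<beta> [x])) \<ominus>\<^bsub>A\<^esub> \<beta> [bracket H x y]"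
proof -
  interpret cring A by fact
  have xy: "[x, y] \<in> tuples H (Suc (Suc 0))"
    using assms(2,3) by (simp add: tuples_def)
  have "{..<Suc 0} = {0}"
    by auto
  then show ?thesis
    using xy assms(4-6)
    by (simp add: differential_def omit_def altsign_def atMost_Suc a_minus_def l_minus a_ac)
qed

context lrj_algebra
begin

lemma cring_A: "cring A"
  using algebra by (simp add: algebra_def)

lemma anchor_closed: "x \<in> carrier G \<Longrightarrow> a \<in> carrier A \<Longrightarrow> anchor G x a \<in> carrier A"
  using anchor_Diff1[of x] by (auto simp: Diff1_def lin_maps_def)

lemma bracket_closed: "x \<in> carrier G \<Longrightarrow> y \<in> carrier G \<Longrightarrow> bracket G x y \<in> carrier G"
  using lie_algebra by (auto simp: lie_algebra_def lin_maps_def restrict_scalars_def)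

lemma differential_cochain0:
  assumes "a \<in> carrier A" "x \<in> carrier G"
  shows "differential A G 0 (cochain0 G a) [x] = anchor G x a"
  using assms differential_degree_0[OF cring_A, of x G "cochain0 G a"]
  by (simp add: cochain0_def tuples_0 anchor_closed)

text \<open>
  Alternation is vacuous in degree one, so only linearity in \<open>x\<close> is at issue: it is the
  \<open>A\<close>-linearity of the anchor.  Membership in the dual is what lets nondegeneracy of \<open>\<omega>\<close> produce
  a symplectic gradient.
\<close>

lemma differential_cochain0_in_dual:
  assumes "a \<in> carrier A"
  shows "differential A G 0 (cochain0 G a) \<in> carrier (cochains A G 1)"
proof -
  interpret module A G by (rule module)
  have "differential A G 0 (cochain0 G a) \<in> tuples G 1 \<rightarrow>\<^sub>E carrier A"
  proof (rule PiE_I)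
    show "differential A G 0 (cochain0 G a) xs \<in> carrier A" if "xs \<in> tuples G 1" for xs
      using that assms by (auto simp: tuples_1 differential_cochain0 anchor_closed)
    show "differential A G 0 (cochain0 G a) xs = undefined" if "xs \<notin> tuples G 1" for xs
      using that by (simp add: differential_def)
  qed
  then show ?thesis
    using assms
    by (auto simp: cochains_def Alt_def tuples_1 differential_cochain0 anchor_add anchor_smult)
qed

end

context symplectic_lrj_algebra
begin

lemma omega_closed_values: "x \<in> carrier G \<Longrightarrow> y \<in> carrier G \<Longrightarrow> \<omega> [x, y] \<in> carrier A"
  using omega_cochain by (auto simp: cochains_def Alt_def tuples_2)

lemma symplectic_gradient_exists:
  assumes "f \<in> carrier A"
  shows "\<exists>x\<in>carrier G. interior G 1 x \<omega> = differential A G 0 (cochain0 G f)"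
proof -
  have "differential A G 0 (cochain0 G f) \<in> (\<lambda>x. interior G 1 x \<omega>) ` carrier G"
    using omega_flat_iso differential_cochain0_in_dual[OF assms]
    by (simp add: module_isos_def bij_betw_def)
  then show ?thesis
    by (metis imageE)
qed

lemma symplectic_gradient_iff:
  assumes "x \<in> carrier G" "f \<in> carrier A"
  shows "x = symplectic_gradient A G \<omega> f \<longleftrightarrow>
    interior G 1 x \<omega> = differential A G 0 (cochain0 G f)"
proof -
  let ?P = "\<lambda>z. z \<in> carrier G \<and> interior G 1 z \<omega> = differential A G 0 (cochain0 G f)"
  have inj: "inj_on (\<lambda>x. interior G 1 x \<omega>) (carrier G)"
    using omega_flat_iso by (simp add: module_isos_def bij_betw_def)
  obtain z where z: "?P z"
    using symplectic_gradient_exists[OF assms(2)] by blast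
  have unique: "w = z" if "?P w" for w
    using inj_onD[OF inj, of w z] that z by simp
  have "symplectic_gradient A G \<omega> f = z"
    unfolding symplectic_gradient_def using z unique by (rule the_equality)
  then show ?thesis
    using assms(1) z unique by blast
qed

lemma symplectic_gradient_closed:
  "f \<in> carrier A \<Longrightarrow> symplectic_gradient A G \<omega> f \<in> carrier G"
  using symplectic_gradient_exists symplectic_gradient_iff by metis

lemma interior_omega_eq_differential_iff:
  assumes "x \<in> carrier G" "f \<in> carrier A"
  shows "interior G 1 x \<omega> = differential A G 0 (cochain0 G f) \<longleftrightarrow>
    (\<forall>y\<in>carrier G. \<omega> [x, y] = anchor G y f)"
proof -
  have "interior G 1 x \<omega> \<in> extensional (tuples G 1)"
    "differential A G 0 (cochain0 G f) \<in> extensional (tuples G 1)"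
    by (simp_all add: interior_def differential_def)
  then have "interior G 1 x \<omega> = differential A G 0 (cochain0 G f) \<longleftrightarrow>
    (\<forall>xs\<in>tuples G 1. interior G 1 x \<omega> xs = differential A G 0 (cochain0 G f) xs)"
    by (rule extensional_eq_iff)
  also have "\<dots> \<longleftrightarrow> (\<forall>y\<in>carrier G. \<omega> [x, y] = anchor G y f)"
    using assms(2) by (auto simp: tuples_1 interior_def differential_cochain0)
  finally show ?thesis .
qed

lemma canonical_form_apply:
  assumes "x \<in> carrier G" "f \<in> carrier A"
  shows "canonical_form A G \<omega> [(x, f)] = f"
  using assms by (simp add: canonical_form_def tuples_def extension_def)

text \<open>
  The bracket of the extension contributes \<open>- (\<rho>(x)(g) - \<rho>(y)(f) + \<omega>(x, y))\<close>, whose first two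
  terms cancel the derivatives of \<open>\<eta>(y + g e) = g\<close> and \<open>\<eta>(x + f e) = f\<close>.
\<close>

lemma differential_canonical_form:
  assumes "x \<in> carrier G" "f \<in> carrier A" "y \<in> carrier G" "g \<in> carrier A"
  shows "differential A (extension A G \<omega>) 1 (canonical_form A G \<omega>) [(x, f), (y, g)] =
    \<ominus>\<^bsub>A\<^esub> \<omega> [x, y]"
proof -
  interpret cring A by (rule cring_A)
  let ?H = "extension A G \<omega>"
  let ?d = "anchor G x g \<ominus>\<^bsub>A\<^esub> anchor G y f"
  note [simp] = assms anchor_closed omega_closed_values bracket_closed canonical_form_apply
  have cancel: "d \<ominus>\<^bsub>A\<^esub> (d \<oplus>\<^bsub>A\<^esub> w) = \<ominus>\<^bsub>A\<^esub> w"
    if "d \<in> carrier A" "w \<in> carrier A" for d w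
    using that by (simp add: a_minus_def minus_add a_assoc[symmetric] r_neg)
  have carrier: "(x, f) \<in> carrier ?H" "(y, g) \<in> carrier ?H"
    by (simp_all add: extension_def)
  have anchor: "anchor ?H (x, f) = anchor G x" "anchor ?H (y, g) = anchor G y"
    by (simp_all add: extension_def)
  have bracket: "bracket ?H (x, f) (y, g) = (bracket G x y, ?d \<oplus>\<^bsub>A\<^esub> \<omega> [x, y])"
    by (simp add: extension_def)
  have "differential A ?H 1 (canonical_form A G \<omega>) [(x, f), (y, g)] =
      ?d \<ominus>\<^bsub>A\<^esub> (?d \<oplus>\<^bsub>A\<^esub> \<omega> [x, y])"
    by (subst differential_degree_1[OF cring_A carrier]) (simp_all add: anchor bracket)
  also have "\<dots> = \<ominus>\<^bsub>A\<^esub> \<omega> [x, y]"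
    by (simp add: cancel)
  finally show ?thesis .
qed

lemma lie_derivative_canonical_form:
  assumes "x \<in> carrier G" "f \<in> carrier A" "y \<in> carrier G" "g \<in> carrier A"
  shows "lie_derivative A (extension A G \<omega>) 1 (x, f) (canonical_form A G \<omega>) [(y, g)] =
    anchor G y f \<ominus>\<^bsub>A\<^esub> \<omega> [x, y]"
proof -
  interpret cring A by (rule cring_A)
  let ?H = "extension A G \<omega>" and ?\<eta> = "canonical_form A G \<omega>"
  note [simp] = assms anchor_closed omega_closed_values canonical_form_apply
  have carrier: "(y, g) \<in> carrier ?H"
    by (simp add: extension_def)
  have anchor: "anchor ?H (y, g) = anchor G y"
    by (simp add: extension_def)
  have tuple: "[(y, g)] \<in> tuples ?H 1"
    using carrier by (simp add: tuples_1)
  have contraction: "interior ?H 0 (x, f) ?\<eta> [] = f"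
    by (simp add: interior_def tuples_0)
  have "lie_derivative A ?H 1 (x, f) ?\<eta> [(y, g)] =
      differential A ?H 1 ?\<eta> [(x, f), (y, g)] \<oplus>\<^bsub>A\<^esub>
      differential A ?H 0 (interior ?H 0 (x, f) ?\<eta>) [(y, g)]"
    using tuple by (simp add: lie_derivative_def cochains_def interior_def)
  also have "\<dots> = \<ominus>\<^bsub>A\<^esub> \<omega> [x, y] \<oplus>\<^bsub>A\<^esub> anchor G y f"
    using differential_degree_0[OF cring_A carrier, of "interior ?H 0 (x, f) ?\<eta>"]
      differential_canonical_form
    by (simp add: contraction anchor)
  also have "\<dots> = anchor G y f \<ominus>\<^bsub>A\<^esub> \<omega> [x, y]"
    by (simp add: a_minus_def a_comm)
  finally show ?thesis .
qed

lemma strict_symmetry_iff: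
  assumes "x \<in> carrier G" "f \<in> carrier A"
  shows "strict_symmetry A (extension A G \<omega>) (canonical_form A G \<omega>) (x, f) \<longleftrightarrow>
    (\<forall>y\<in>carrier G. \<omega> [x, y] = anchor G y f)"
proof -
  interpret cring A by (rule cring_A)
  let ?H = "extension A G \<omega>" and ?\<eta> = "canonical_form A G \<omega>"
  have minus_eq_zero_iff: "a \<ominus>\<^bsub>A\<^esub> b = \<zero>\<^bsub>A\<^esub> \<longleftrightarrow> b = a"
    if "a \<in> carrier A" "b \<in> carrier A" for a b
    using that minus_equality[of a "\<ominus>\<^bsub>A\<^esub> b"] by (auto simp: a_minus_def r_neg)
  let ?L = "lie_derivative A ?H 1 (x, f) ?\<eta>"
  have "?L \<in> extensional (tuples ?H 1)" "\<zero>\<^bsub>cochains A ?H 1\<^esub> \<in> extensional (tuples ?H 1)"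
    by (simp_all add: lie_derivative_def cochains_def)
  then have "strict_symmetry A ?H ?\<eta> (x, f) \<longleftrightarrow>
      (\<forall>vs\<in>tuples ?H 1. ?L vs = \<zero>\<^bsub>cochains A ?H 1\<^esub> vs)"
    unfolding strict_symmetry_def by (rule extensional_eq_iff)
  also have "\<dots> \<longleftrightarrow> (\<forall>v\<in>carrier ?H. ?L [v] = \<zero>\<^bsub>A\<^esub>)"
    by (auto simp: tuples_1 cochains_def)
  also have "\<dots> \<longleftrightarrow> (\<forall>y\<in>carrier G. \<forall>g\<in>carrier A. anchor G y f \<ominus>\<^bsub>A\<^esub> \<omega> [x, y] = \<zero>\<^bsub>A\<^esub>)"
    using lie_derivative_canonical_form[OF assms] by (auto simp: extension_def)
  \<comment> \<open>The condition does not involve \<open>g\<close>, and \<open>carrier A\<close> contains zero, so the quantifier over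
    \<open>g\<close> can be dropped: this is the surjectivity of \<open>\<pi>\<close>.\<close>
  also have "\<dots> \<longleftrightarrow> (\<forall>y\<in>carrier G. \<omega> [x, y] = anchor G y f)"
    using assms by (auto simp: minus_eq_zero_iff anchor_closed omega_closed_values)
  finally show ?thesis .
qed

end

theorem theorem6p3:
  fixes K :: "('k, 'r) ring_scheme"
    and A :: "('k, 'a, 'm) module_scheme"
    and G :: "('a, 'g, 'n) lrj_scheme"
    and \<omega> :: "'g list \<Rightarrow> 'a"
  assumes "symplectic_lrj_algebra K A G \<omega>"
  shows "(\<forall>x\<in>carrier G. \<forall>f\<in>carrier A.
            strict_symmetry A (extension A G \<omega>) (canonical_form A G \<omega>) (x, f)
              \<longleftrightarrow> x = symplectic_gradient A G \<omega> f) \<and>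
         Cont_str A (extension A G \<omega>) (canonical_form A G \<omega>) =
           {(symplectic_gradient A G \<omega> f, f) | f. f \<in> carrier A}"
proof -
  interpret symplectic_lrj_algebra K A G \<omega> by fact
  have iff: "strict_symmetry A (extension A G \<omega>) (canonical_form A G \<omega>) (x, f) \<longleftrightarrow>
      x = symplectic_gradient A G \<omega> f" if "x \<in> carrier G" "f \<in> carrier A" for x f
    using that
    by (simp only: strict_symmetry_iff symplectic_gradient_iff interior_omega_eq_differential_iff)
  have "carrier (extension A G \<omega>) = carrier G \<times> carrier A"
    by (simp add: extension_def)
  then have "Cont_str A (extension A G \<omega>) (canonical_form A G \<omega>) =
      {(symplectic_gradient A G \<omega> f, f) | f. f \<in> carrier A}"
    using iff symplectic_gradient_closed by (auto simp: Cont_str_def)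
  with iff show ?thesis
    by blast
qed

end
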